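(* For every $0<c<1$, the pair $(X_c^*,X_c^* )$ has the weak maximizing property.
   Context: All Banach spaces are real; $E^*$ is the dual of $E$ with the dual norm. $\mathcal L(E,F)$ denotes the bounded linear operators from $E$ to $F$; $S_E$ is the unit sphere of $E$. An operator $T\in\mathcal L(E,F)$ attains its norm if $\|Tx\|=\|T\|$ for some $x\in S_E$. A sequence $(x_n)\subset S_E$ is a maximizing sequence for $T$ if $\|Tx_n\|\to\|T\|$. A pair $(E,F)$ has the weak maximizing property (WMP) if every $T\in\mathcal L(E,F)$ which admits a maximizing sequence that is not weakly null attains its norm. Definition of $X_c$. A norm $N$ on $\mathbb R^2$ is absolute if $N(s,t)=N(|s|,|t|)$ and normalized if $N(1,0)=N(0,1)=1$. Given a sequence $(N_n)_{n\ge1}$ of absolute normalized norms on $\mathbb R^2$, define norms $M_n$ on $\mathbb R^{n+1}$ by $M_0(x_0)=|x_0|$ and $M_n(x_0,\dots,x_n)=N_n(M_{n-1}(x_0,\dots,x_{n-1}),|x_n|)$ for $n\ge1$. For a finitely supported real sequence $x=(x_j)_{j\ge0}\in c_{00}$ put $\|x\|=M_n(x_0,\dots,x_n)$ for any $n$ with $x_j=0$ for all $j>n$ (this is independent of $n$). $A(N_n)$ denotes the completion of $c_{00}$ in this norm, with canonical basis $(e_j)_{j\ge0}$. For $0<c<1$ and $n\ge1$ let $$N_{n,c}(s,t)=\left[(1-c^{2n})|t|^{2n}+(s^2+c^2t^2)^n\right]^{1/(2n)},$$ which is an absolute normalized norm on $\mathbb R^2$, and set $X_c:=A(N_{n,c})$.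 *)

theory Defs
  imports "HOL-Analysis.Analysis"
begin

definition absolute_normalized_norm :: "(real \<Rightarrow> real \<Rightarrow> real) \<Rightarrow> bool" where
  "absolute_normalized_norm N \<longleftrightarrow>
     (\<forall>s t. N s t = 0 \<longleftrightarrow> s = 0 \<and> t = 0) \<and>
     (\<forall>a s t. N (a * s) (a * t) = \<bar>a\<bar> * N s t) \<and>
     (\<forall>s t s' t'. N (s + s') (t + t') \<le> N s t + N s' t') \<and>
     (\<forall>s t. N s t = N \<bar>s\<bar> \<bar>t\<bar>) \<and>
     N 1 0 = 1 \<and> N 0 1 = 1"

lemma absolute_normalized_normD:
  assumes "absolute_normalized_norm N"
  shows "N s t = 0 \<longleftrightarrow> s = 0 \<and> t = 0"
    and "N (a * s) (a * t) = \<bar>a\<bar> * N s t"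
    and "N (s + s') (t + t') \<le> N s t + N s' t'"
    and "N \<bar>s\<bar> \<bar>t\<bar> = N s t"
    and "N 1 0 = 1" "N 0 1 = 1"
  using assms by (auto simp: absolute_normalized_norm_def)

lemma absolute_normalized_norm_nonneg:
  assumes "absolute_normalized_norm N"
  shows "0 \<le> N s t"
proof -
  have "N (s + (- 1) * s) (t + (- 1) * t) \<le> N s t + N ((- 1) * s) ((- 1) * t)"
    by (rule absolute_normalized_normD(3)[OF assms])
  also have "\<dots> = 2 * N s t"
    by (simp only: absolute_normalized_normD(2)[OF assms] abs_minus_cancel abs_one)
  finally show ?thesis
    using absolute_normalized_normD(1)[OF assms, of 0 0] by simp
qed

lemma absolute_normalized_norm_axis:
  assumes "absolute_normalized_norm N"
  shows "N s 0 = \<bar>s\<bar>"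
  using absolute_normalized_normD(2)[OF assms, of s 1 0] absolute_normalized_normD(5)[OF assms]
  by simp

lemma absolute_normalized_norm_mono1:
  assumes N: "absolute_normalized_norm N" and s: "0 \<le> s" "s \<le> s'"
  shows "N s t \<le> N s' t"
proof (cases "s' = 0")
  case True
  then show ?thesis using s by simp
next
  case False
  define a where "a = (1 + s / s') / 2"
  define b where "b = (1 - s / s') / 2"
  have ab: "a \<ge> 0" "b \<ge> 0" "a + b = 1" "a * s' + b * (- s') = s"
    using False s by (auto simp: a_def b_def field_simps)
  have "N s t = N (a * s' + b * (- s')) (a * t + b * t)"
    using ab by (simp flip: distrib_right)
  also have "\<dots> \<le> N (a * s') (a * t) + N (b * (- s')) (b * t)"
    by (rule absolute_normalized_normD(3)[OF N])
  also have "\<dots> = a * N s' t + b * N (- s') t"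
    using ab by (simp only: absolute_normalized_normD(2)[OF N] abs_of_nonneg)
  also have "N (- s') t = N s' t"
    using absolute_normalized_normD(4)[OF N, of "- s'" t] absolute_normalized_normD(4)[OF N, of s' t]
    by simp
  also have "a * N s' t + b * N s' t = N s' t"
    using ab by (simp flip: distrib_right)
  finally show ?thesis .
qed

lemma absolute_normalized_norm_swap:
  "absolute_normalized_norm N \<Longrightarrow> absolute_normalized_norm (\<lambda>s t. N t s)"
  unfolding absolute_normalized_norm_def by blast

lemma absolute_normalized_norm_mono:
  assumes N: "absolute_normalized_norm N" and "0 \<le> s" "s \<le> s'" "0 \<le> t" "t \<le> t'"
  shows "N s t \<le> N s' t'"
  using absolute_normalized_norm_mono1[OF N, of s s' t]
    absolute_normalized_norm_mono1[OF absolute_normalized_norm_swap[OF N], of t t' s'] assms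
  by simp

text \<open>Only the entries \<open>N n\<close> with \<open>n \<ge> 1\<close> of the sequence \<open>N\<close> are used.\<close>

primrec M_norm ::
  "(nat \<Rightarrow> real \<Rightarrow> real \<Rightarrow> real) \<Rightarrow> nat \<Rightarrow> (nat \<Rightarrow> real) \<Rightarrow> real" where
  "M_norm N 0 x = \<bar>x 0\<bar>"
| "M_norm N (Suc n) x = N (Suc n) (M_norm N n x) \<bar>x (Suc n)\<bar>"

definition c00 :: "(nat \<Rightarrow> real) set" where
  "c00 = {x. finite {j. x j \<noteq> 0}}"

definition A_norm :: "(nat \<Rightarrow> real \<Rightarrow> real \<Rightarrow> real) \<Rightarrow> (nat \<Rightarrow> real) \<Rightarrow> real" where
  "A_norm N x = M_norm N (LEAST n. \<forall>j>n. x j = 0) x"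

lemma c00_iff_bounded_support: "x \<in> c00 \<longleftrightarrow> (\<exists>n. \<forall>j>n. x j = 0)"
proof -
  have "(\<forall>j\<in>{j. x j \<noteq> 0}. j \<le> n) \<longleftrightarrow> (\<forall>j>n. x j = 0)" for n
    by (auto simp: not_less[symmetric])
  then show ?thesis
    by (simp add: c00_def finite_nat_set_iff_bounded_le)
qed

lemma M_norm_nonneg:
  assumes "\<And>n. n \<ge> 1 \<Longrightarrow> absolute_normalized_norm (N n)"
  shows "0 \<le> M_norm N n x"
proof (cases n)
  case (Suc k)
  then show ?thesis
    using absolute_normalized_norm_nonneg[OF assms, of "Suc k"] by simp
qed simp

lemma A_norm_eq_M_norm:
  assumes N: "\<And>n. n \<ge> 1 \<Longrightarrow> absolute_normalized_norm (N n)"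
    and n: "\<forall>j>n. x j = 0"
  shows "A_norm N x = M_norm N n x"
proof -
  define m where "m = (LEAST n. \<forall>j>n. x j = 0)"
  have m: "\<forall>j>m. x j = 0"
    unfolding m_def by (rule LeastI) (rule n)
  have "m \<le> n"
    unfolding m_def by (rule Least_le) (rule n)
  then have "M_norm N n x = M_norm N m x"
  proof (induction n rule: dec_induct)
    case (step k)
    then show ?case
      using m M_norm_nonneg[of N k x, OF N] absolute_normalized_norm_axis[OF N[of "Suc k"]]
      by simp
  qed simp
  then show ?thesis
    by (simp add: A_norm_def m_def)
qed

lemma M_norm_triangle:
  assumes N: "\<And>n. n \<ge> 1 \<Longrightarrow> absolute_normalized_norm (N n)"
  shows "M_norm N n (\<lambda>j. x j + y j) \<le> M_norm N n x + M_norm N n y"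
proof (induction n)
  case (Suc n)
  have N': "absolute_normalized_norm (N (Suc n))"
    by (rule N) simp
  have "M_norm N (Suc n) (\<lambda>j. x j + y j)
      \<le> N (Suc n) (M_norm N n x + M_norm N n y) (\<bar>x (Suc n)\<bar> + \<bar>y (Suc n)\<bar>)"
    using Suc M_norm_nonneg[OF N] by (auto intro!: absolute_normalized_norm_mono[OF N'])
  also have "\<dots> \<le> M_norm N (Suc n) x + M_norm N (Suc n) y"
    using absolute_normalized_normD(3)[OF N'] by simp
  finally show ?case .
qed simp

lemma M_norm_scale:
  assumes N: "\<And>n. n \<ge> 1 \<Longrightarrow> absolute_normalized_norm (N n)"
  shows "M_norm N n (\<lambda>j. a * x j) = \<bar>a\<bar> * M_norm N n x"
proof (induction n)
  case (Suc n)
  have N': "absolute_normalized_norm (N (Suc n))"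
    by (rule N) simp
  show ?case
    using Suc absolute_normalized_normD(2)[OF N', of "\<bar>a\<bar>"] by (simp add: abs_mult)
qed (simp add: abs_mult)

lemma M_norm_eq_0_iff:
  assumes N: "\<And>n. n \<ge> 1 \<Longrightarrow> absolute_normalized_norm (N n)"
  shows "M_norm N n x = 0 \<longleftrightarrow> (\<forall>j\<le>n. x j = 0)"
proof (induction n)
  case (Suc n)
  have N': "absolute_normalized_norm (N (Suc n))"
    by (rule N) simp
  show ?case
    using Suc absolute_normalized_normD(1)[OF N'] by (auto simp: le_Suc_eq)
qed simp

lemma A_norm_is_norm:
  assumes N: "\<And>n. n \<ge> 1 \<Longrightarrow> absolute_normalized_norm (N n)"
    and x: "x \<in> c00" and y: "y \<in> c00"
  shows "A_norm N x = 0 \<longleftrightarrow> x = (\<lambda>_. 0)"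
    and "A_norm N (\<lambda>j. a * x j) = \<bar>a\<bar> * A_norm N x"
    and "A_norm N (\<lambda>j. x j + y j) \<le> A_norm N x + A_norm N y"
proof -
  obtain k l where kl: "\<forall>j>k. x j = 0" "\<forall>j>l. y j = 0"
    using x y by (auto simp: c00_iff_bounded_support)
  define n where "n = max k l"
  have n: "\<forall>j>n. x j = 0" "\<forall>j>n. y j = 0"
    using kl by (auto simp: n_def)
  have *: "A_norm N z = M_norm N n z" if "\<forall>j>n. z j = 0" for z
    using that by (intro A_norm_eq_M_norm[of N, OF N])
  show "A_norm N x = 0 \<longleftrightarrow> x = (\<lambda>_. 0)"
    using n(1) by (auto simp: * M_norm_eq_0_iff[of N, OF N] fun_eq_iff not_le[symmetric])
  show "A_norm N (\<lambda>j. a * x j) = \<bar>a\<bar> * A_norm N x"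
    using n(1) by (simp add: * M_norm_scale[of N, OF N])
  show "A_norm N (\<lambda>j. x j + y j) \<le> A_norm N x + A_norm N y"
    using n by (simp add: * M_norm_triangle[of N, OF N])
qed

text \<open>
  As the norm depends on parameters that are values rather than types, the completion of
  \<open>c\<^sub>0\<^sub>0\<close> is not constructed as one type.  Instead, a Banach space \<open>'a\<close>
  together with a map \<open>J\<close> is said to be a completion of \<open>c\<^sub>0\<^sub>0\<close> if \<open>J\<close> is linear and
  isometric on \<open>c\<^sub>0\<^sub>0\<close> and has dense range.  This determines \<open>'a\<close> up to a linear isometric
  isomorphism.  The values of \<open>J\<close> outside \<open>c\<^sub>0\<^sub>0\<close> are irrelevant.
\<close>

definition is_A_completion ::
  "(nat \<Rightarrow> real \<Rightarrow> real \<Rightarrow> real) \<Rightarrow> ((nat \<Rightarrow> real) \<Rightarrow> 'a::banach) \<Rightarrow> bool" where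
  "is_A_completion N J \<longleftrightarrow>
     (\<forall>x\<in>c00. \<forall>y\<in>c00. J (\<lambda>j. x j + y j) = J x + J y) \<and>
     (\<forall>a. \<forall>x\<in>c00. J (\<lambda>j. a * x j) = a *\<^sub>R J x) \<and>
     (\<forall>x\<in>c00. norm (J x) = A_norm N x) \<and>
     closure (J ` c00) = UNIV"

definition Nc :: "real \<Rightarrow> nat \<Rightarrow> real \<Rightarrow> real \<Rightarrow> real" where
  "Nc c n s t =
     root (2 * n) ((1 - c ^ (2 * n)) * \<bar>t\<bar> ^ (2 * n) + (s\<^sup>2 + c\<^sup>2 * t\<^sup>2) ^ n)"

definition is_Xc :: "real \<Rightarrow> ((nat \<Rightarrow> real) \<Rightarrow> 'a::banach) \<Rightarrow> bool" where
  "is_Xc c J \<longleftrightarrow> is_A_completion (Nc c) J"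

lemma absolute_normalized_norm_Nc:
  assumes c: "0 < c" "c < 1" and n: "n \<ge> 1"
  shows "absolute_normalized_norm (Nc c n)"
proof -
  define d where "d = 1 - c ^ (2 * n)"
  have "c ^ (2 * n) < 1"
    using c n by (intro power_Suc_less_one power_less_one_iff[THEN iffD2]) auto
  then have d: "d > 0"
    by (simp add: d_def)
  define q where "q = (\<lambda>s t. cmod (Complex s (c * t)))"
  define f where "f = (\<lambda>s t. d * \<bar>t\<bar> ^ (2 * n) + q s t ^ (2 * n))"
  have q_triangle: "q (s + s') (t + t') \<le> q s t + q s' t'" for s t s' t'
    unfolding q_def using norm_triangle_ineq[of "Complex s (c * t)" "Complex s' (c * t')"]
    by (simp add: complex_add distrib_left)
  have q_scale: "q (a * s) (a * t) = \<bar>a\<bar> * q s t" for a s t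
  proof -
    have "Complex (a * s) (c * (a * t)) = a *\<^sub>R Complex s (c * t)"
      by (simp add: complex_eq_iff)
    then show ?thesis
      unfolding q_def by (simp only: norm_scaleR)
  qed
  have q0: "q s t \<ge> 0" for s t
    by (simp add: q_def)
  have f0: "f s t \<ge> 0" for s t
    using d q0 by (simp add: f_def)
  have f_eq_0: "f s t = 0 \<longleftrightarrow> s = 0 \<and> t = 0" for s t
    using d q0 n c by (auto simp: f_def add_nonneg_eq_0_iff q_def complex_eq_iff)
  have f_scale: "f (a * s) (a * t) = \<bar>a\<bar> ^ (2 * n) * f s t" for a s t
    by (simp add: f_def q_scale abs_mult power_mult_distrib algebra_simps)
  have Nf: "Nc c n s t = root (2 * n) (f s t)" for s t
    by (simp add: Nc_def f_def d_def q_def cmod_def power_mult power_mult_distrib)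
  have N0: "Nc c n s t \<ge> 0" for s t
    using f0 by (simp add: Nf real_root_pos_pos_le)
  have N_pow: "Nc c n s t ^ (2 * n) = f s t" for s t
    using f0 n by (simp add: Nf)
  have N_eq_0: "Nc c n s t = 0 \<longleftrightarrow> s = 0 \<and> t = 0" for s t
    using n by (simp add: Nf f_eq_0)
  have N_scale: "Nc c n (a * s) (a * t) = \<bar>a\<bar> * Nc c n s t" for a s t
    using n by (simp add: Nf f_scale real_root_mult real_root_power_cancel)
  have pow_convex: "(u * x + v * y) ^ (2 * n) \<le> u * x ^ (2 * n) + v * y ^ (2 * n)"
    if "u \<ge> 0" "v \<ge> 0" "u + v = 1" for u v x y :: real
    using convex_onD[OF convex_power_even[of "2 * n"], of v x y] that
    by (simp add: eq_diff_eq[symmetric])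
  have f_convex: "f (u * s + v * s') (u * t + v * t') \<le> u * f s t + v * f s' t'"
    if uv: "u \<ge> 0" "v \<ge> 0" "u + v = 1" for u v s t s' t'
  proof -
    have "\<bar>u * t + v * t'\<bar> \<le> u * \<bar>t\<bar> + v * \<bar>t'\<bar>"
      using abs_triangle_ineq[of "u * t" "v * t'"] uv by (simp add: abs_mult)
    then have "\<bar>u * t + v * t'\<bar> ^ (2 * n) \<le> (u * \<bar>t\<bar> + v * \<bar>t'\<bar>) ^ (2 * n)"
      by (intro power_mono) auto
    also have "\<dots> \<le> u * \<bar>t\<bar> ^ (2 * n) + v * \<bar>t'\<bar> ^ (2 * n)"
      by (rule pow_convex[OF uv])
    finally have 1: "d * \<bar>u * t + v * t'\<bar> ^ (2 * n) \<le> d * (u * \<bar>t\<bar> ^ (2 * n) + v * \<bar>t'\<bar> ^ (2 * n))"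
      using d by (intro mult_left_mono) auto
    have "q (u * s + v * s') (u * t + v * t') \<le> u * q s t + v * q s' t'"
      using q_triangle[of "u * s" "v * s'" "u * t" "v * t'"] uv by (simp add: q_scale)
    then have "q (u * s + v * s') (u * t + v * t') ^ (2 * n) \<le> (u * q s t + v * q s' t') ^ (2 * n)"
      using q0 by (intro power_mono) auto
    also have "\<dots> \<le> u * q s t ^ (2 * n) + v * q s' t' ^ (2 * n)"
      by (rule pow_convex[OF uv])
    finally show ?thesis
      using 1 by (simp add: f_def algebra_simps)
  qed
  have N_triangle: "Nc c n (s + s') (t + t') \<le> Nc c n s t + Nc c n s' t'" for s t s' t'
  proof (cases "Nc c n s t = 0 \<or> Nc c n s' t' = 0")
    case True
    then show ?thesis
      using N0 by (auto simp: N_eq_0)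
  next
    case False
    define A where "A = Nc c n s t"
    define B where "B = Nc c n s' t'"
    have AB: "A > 0" "B > 0"
      using False N0[of s t] N0[of s' t'] by (auto simp: A_def B_def)
    define u where "u = A / (A + B)"
    define v where "v = B / (A + B)"
    have uv: "u \<ge> 0" "v \<ge> 0" "u + v = 1"
      using AB by (auto simp: u_def v_def add_divide_distrib[symmetric])
    have unit: "f (s / A) (t / A) = 1" "f (s' / B) (t' / B) = 1"
      using f_scale[of "1 / A" s t] f_scale[of "1 / B" s' t'] AB
      by (auto simp: power_divide A_def B_def simp flip: N_pow)
    have eq: "u * (s / A) + v * (s' / B) = (s + s') / (A + B)"
      "u * (t / A) + v * (t' / B) = (t + t') / (A + B)"
      using AB by (auto simp: u_def v_def add_divide_distrib)
    have "f ((s + s') / (A + B)) ((t + t') / (A + B)) \<le> 1"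
      using f_convex[OF uv, of "s / A" "s' / B" "t / A" "t' / B"] uv
      unfolding eq unit by simp
    then have "Nc c n ((s + s') / (A + B)) ((t + t') / (A + B)) \<le> 1"
      using n by (simp add: Nf)
    moreover have "Nc c n ((s + s') / (A + B)) ((t + t') / (A + B))
        = Nc c n (s + s') (t + t') / (A + B)"
      using N_scale[of "1 / (A + B)" "s + s'" "t + t'"] AB by simp
    ultimately have "Nc c n (s + s') (t + t') \<le> A + B"
      using AB by (simp add: divide_le_eq)
    then show ?thesis
      by (simp add: A_def B_def)
  qed
  have "Nc c n s t = Nc c n \<bar>s\<bar> \<bar>t\<bar>" for s t
    by (simp add: Nc_def)
  moreover have "Nc c n 1 0 = 1"
    using n by (simp add: Nc_def)
  moreover have "Nc c n 0 1 = 1"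
    using n by (simp add: Nc_def power_mult)
  ultimately show ?thesis
    unfolding absolute_normalized_norm_def
    by (intro conjI allI N_eq_0 N_scale N_triangle)
qed

definition attains_norm :: "('e::real_normed_vector \<Rightarrow>\<^sub>L 'f::real_normed_vector) \<Rightarrow> bool" where
  "attains_norm T \<longleftrightarrow> (\<exists>x. norm x = 1 \<and> norm (blinfun_apply T x) = norm T)"

definition maximizing_sequence ::
  "('e::real_normed_vector \<Rightarrow>\<^sub>L 'f::real_normed_vector) \<Rightarrow> (nat \<Rightarrow> 'e) \<Rightarrow> bool" where
  "maximizing_sequence T x \<longleftrightarrow>
     (\<forall>n. norm (x n) = 1) \<and> (\<lambda>n. norm (blinfun_apply T (x n))) \<longlonglongrightarrow> norm T"

definition weakly_null :: "(nat \<Rightarrow> 'e::real_normed_vector) \<Rightarrow> bool" where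
  "weakly_null x \<longleftrightarrow>
     (\<forall>\<phi> :: 'e \<Rightarrow>\<^sub>L real. (\<lambda>n. blinfun_apply \<phi> (x n)) \<longlonglongrightarrow> 0)"

definition weak_maximizing_property :: "'e::banach itself \<Rightarrow> 'f::banach itself \<Rightarrow> bool" where
  "weak_maximizing_property E F \<longleftrightarrow>
     (\<forall>T :: 'e \<Rightarrow>\<^sub>L 'f.
        (\<exists>x. maximizing_sequence T x \<and> \<not> weakly_null x) \<longrightarrow> attains_norm T)"

end

theory Submission
  imports Defs "HOL-Complex_Analysis.Great_Picard"
begin

text \<open>
  Write \<open>X\<close> for the completion \<open>X\<^sub>c\<close> and \<open>\<parallel>x\<parallel>\<close> for its norm.  Each plane norm satisfies
  \<open>s\<^sup>2 + c\<^sup>2 t\<^sup>2 \<le> N(s,t)\<^sup>2 \<le> s\<^sup>2 + t\<^sup>2\<close>, so that \<open>X\<close> is isomorphic to \<open>\<ell>\<^sub>2\<close>; in particular \<open>X\<close> is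
  reflexive, and truncations of a functional converge to it in norm.  Two features of the norm
  itself do the work.  If \<open>x\<close> is supported on \<open>{0..m}\<close> and \<open>u\<close> beyond \<open>m\<close>, then

  \<^item> \<open>\<parallel>x + u\<parallel>\<close> depends on \<open>x\<close> only through \<open>\<parallel>x\<parallel>\<close>, and is nondecreasing in it;
  \<^item> \<open>\<parallel>x + u\<parallel>\<^sup>2 \<le> \<parallel>x\<parallel>\<^sup>2 + \<parallel>u\<parallel>\<^sup>2\<close>.

  By duality, functionals \<open>f\<close> on \<open>{0..m}\<close> and \<open>g\<close> beyond \<open>m\<close> have the same monotonicity
  (\<open>dual_mono_head\<close>) and satisfy \<open>\<parallel>f\<parallel>\<^sup>2 + \<parallel>g\<parallel>\<^sup>2 \<le> \<parallel>f + g\<parallel>\<^sup>2\<close> (\<open>dual_pythagoras\<close>).  A weakly null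
  sequence in \<open>X\<^sup>*\<close> lives asymptotically beyond every \<open>m\<close>.  Hence, if \<open>(g\<^sub>n)\<close> is weakly null and
  \<open>\<parallel>f\<parallel> < \<parallel>f'\<parallel>\<close>, then \<open>\<parallel>f + g\<^sub>n\<parallel> \<le> \<parallel>f' + g\<^sub>n\<parallel> + \<eta>\<close> eventually (\<open>norm_add_weakly_null_mono\<close>), which is a
  form of Kalton's property \<open>(M)\<close>; and if \<open>f \<noteq> 0\<close> and \<open>\<parallel>f + g\<^sub>n\<parallel> \<le> 1\<close>, then the norms \<open>\<parallel>g\<^sub>n\<parallel>\<close> are
  eventually bounded away from \<open>1\<close> (\<open>norm_weakly_null_less\<close>).

  Now let an operator \<open>T\<close> on \<open>X\<^sup>*\<close> have a maximizing sequence that is not weakly null.  A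
  subsequence has the form \<open>f + g\<^sub>n\<close> with \<open>f \<noteq> 0\<close> and \<open>(g\<^sub>n)\<close> weakly null.  Suppose that
  \<open>\<parallel>T f\<parallel> < \<parallel>T\<parallel> \<parallel>f\<parallel>\<close>.  Then some \<open>z\<close> with \<open>\<parallel>z\<parallel> < \<parallel>f\<parallel>\<close> has \<open>\<parallel>T z\<parallel> > \<parallel>T f\<parallel>\<close>.  Choose \<open>\<theta> < 1\<close> with
  \<open>\<parallel>z\<parallel> < \<theta> \<parallel>f\<parallel>\<close>.  Up to arbitrarily small errors, property \<open>(M)\<close>, applied first in the range and
  then in the domain of \<open>T\<close>, gives
  \<open>\<parallel>T (f + g\<^sub>n)\<parallel> \<le> \<parallel>T (z + g\<^sub>n)\<parallel> \<le> \<parallel>T\<parallel> \<parallel>z + g\<^sub>n\<parallel> \<le> \<parallel>T\<parallel> \<parallel>\<theta> f + g\<^sub>n\<parallel> \<le> \<parallel>T\<parallel> (\<theta> + (1 - \<theta>) \<parallel>g\<^sub>n\<parallel>)\<close>,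
  which stays away from \<open>\<parallel>T\<parallel>\<close>: the sequence is not maximizing.  So \<open>T\<close> attains its norm at
  \<open>f / \<parallel>f\<parallel>\<close> (\<open>attained_at_weak_limit\<close>).
\<close>

section \<open>The norms on the plane\<close>

lemma Nc_power:
  assumes "0 < c" "c < 1" "n \<ge> 1"
  shows "((Nc c n s t)\<^sup>2) ^ n = (1 - c ^ (2 * n)) * \<bar>t\<bar> ^ (2 * n) + (s\<^sup>2 + c\<^sup>2 * t\<^sup>2) ^ n"
proof -
  have "0 \<le> (1 - c ^ (2 * n)) * \<bar>t\<bar> ^ (2 * n) + (s\<^sup>2 + c\<^sup>2 * t\<^sup>2) ^ n"
    using assms by (intro add_nonneg_nonneg mult_nonneg_nonneg) (auto simp: power_le_one)
  then show ?thesis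
    using assms by (simp add: Nc_def flip: power_mult)
qed

lemma Nc_lower:
  assumes "0 < c" "c < 1" "n \<ge> 1"
  shows "s\<^sup>2 + c\<^sup>2 * t\<^sup>2 \<le> (Nc c n s t)\<^sup>2"
proof (rule power_le_imp_le_base)
  have "0 \<le> (1 - c ^ (2 * n)) * \<bar>t\<bar> ^ (2 * n)"
    using assms by (intro mult_nonneg_nonneg) (auto simp: power_le_one)
  then show "(s\<^sup>2 + c\<^sup>2 * t\<^sup>2) ^ Suc (n - 1) \<le> ((Nc c n s t)\<^sup>2) ^ Suc (n - 1)"
    using assms Nc_power[OF assms, of s t] by simp
qed simp

text \<open>
  Both \<open>b\<^sup>n - a\<^sup>n\<close> and \<open>(b + s)\<^sup>n - (a + s)\<^sup>n\<close> have the factor \<open>b - a\<close>; the cofactors compare term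
  by term.
\<close>

lemma power_increment_mono:
  fixes a b s :: real
  assumes "0 \<le> a" "a \<le> b" "0 \<le> s"
  shows "b ^ n + (a + s) ^ n \<le> (b + s) ^ n + a ^ n"
proof -
  have "b ^ n - a ^ n = (b - a) * (\<Sum>i<n. a ^ (n - Suc i) * b ^ i)"
    by (rule power_diff_sumr2)
  also have "\<dots> \<le> (b - a) * (\<Sum>i<n. (a + s) ^ (n - Suc i) * (b + s) ^ i)"
    using assms by (intro mult_left_mono sum_mono mult_mono power_mono) auto
  also have "\<dots> = (b + s) ^ n - (a + s) ^ n"
    using power_diff_sumr2[of "b + s" n "a + s"] by simp
  finally show ?thesis
    by simp
qed

text \<open>
  The square of the plane norm is the \<open>\<ell>\<^sub>n\<close>-norm of the pair
  \<open>((1 - c\<^sup>2\<^sup>n)\<^bsup>1/n\<^esup> t\<^sup>2, b\<^sup>2 + c\<^sup>2 t\<^sup>2)\<close>, and adding \<open>s\<^sup>2\<close> to one entry raises an \<open>\<ell>\<^sub>n\<close>-norm by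
  at most \<open>s\<^sup>2\<close>.  This is the step of the induction that proves the Pythagorean inequality for
  heads and tails; the case \<open>b = 0\<close> gives the upper \<open>\<ell>\<^sub>2\<close>-estimate.
\<close>

lemma Nc_pythagoras:
  assumes "0 < c" "c < 1" "n \<ge> 1" and "a\<^sup>2 \<le> s\<^sup>2 + b\<^sup>2"
  shows "(Nc c n a t)\<^sup>2 \<le> s\<^sup>2 + (Nc c n b t)\<^sup>2"
proof (rule power_le_imp_le_base)
  note c = assms(1-3)
  define y where "y = (Nc c n b t)\<^sup>2"
  have "((Nc c n a t)\<^sup>2) ^ n \<le> (1 - c ^ (2 * n)) * \<bar>t\<bar> ^ (2 * n) + (b\<^sup>2 + c\<^sup>2 * t\<^sup>2 + s\<^sup>2) ^ n"
    unfolding Nc_power[OF c] using assms by (intro add_left_mono power_mono) auto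
  also have "\<dots> = y ^ n + (b\<^sup>2 + c\<^sup>2 * t\<^sup>2 + s\<^sup>2) ^ n - (b\<^sup>2 + c\<^sup>2 * t\<^sup>2) ^ n"
    by (simp add: y_def Nc_power[OF c])
  also have "\<dots> \<le> (y + s\<^sup>2) ^ n"
    using power_increment_mono[of "b\<^sup>2 + c\<^sup>2 * t\<^sup>2" y "s\<^sup>2" n] Nc_lower[OF c, of b t]
    by (simp add: y_def)
  finally show "((Nc c n a t)\<^sup>2) ^ Suc (n - 1) \<le> (s\<^sup>2 + (Nc c n b t)\<^sup>2) ^ Suc (n - 1)"
    using c by (simp add: y_def add.commute)
qed simp

lemma mult_self_le_imp_le:
  fixes x C :: real
  assumes "x * x \<le> C * x" "0 \<le> x" "0 \<le> C"
  shows "x \<le> C"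
  using assms by (cases "x = 0") (auto simp: mult_le_cancel_right)

lemma exists_small_multiple:
  fixes s \<eta> :: real
  assumes "0 \<le> s" "0 < \<eta>"
  obtains \<delta> where "0 < \<delta>" "s * \<delta> \<le> \<eta>"
  using assms by (intro that[of "\<eta> / (s + 1)"]) (auto simp: field_simps)

text \<open>
  Partial sums of squares that stay bounded are Cauchy.  The \<open>\<ell>\<^sub>2\<close>-estimates turn this into
  convergence of truncated functionals and of partial sums in the completion.
\<close>

lemma L2_set_tail_small:
  fixes b :: "nat \<Rightarrow> real"
  assumes "\<And>m. L2_set b {..m} \<le> C" and "0 < \<epsilon>"
  obtains M where "\<And>m n. M \<le> m \<Longrightarrow> L2_set b {m<..n} < \<epsilon>"
proof -
  have "(\<Sum>j\<le>m. (b j)\<^sup>2) \<le> C\<^sup>2" for m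
    using power_mono[OF assms(1)[of m], of 2] by (simp add: L2_set_def sum_nonneg)
  then have "summable (\<lambda>j. (b j)\<^sup>2)"
    by (intro bounded_imp_summable[of _ "C\<^sup>2"]) auto
  then obtain M where M: "\<And>m n. M \<le> m \<Longrightarrow> norm (\<Sum>j=m..<n. (b j)\<^sup>2) < \<epsilon>\<^sup>2"
    using \<open>0 < \<epsilon>\<close> unfolding summable_Cauchy by (meson zero_less_power)
  have "L2_set b {m<..n} < \<epsilon>" if "M \<le> m" for m n
  proof -
    have "{m<..n} = {Suc m..<Suc n}"
      by auto
    then have "(L2_set b {m<..n})\<^sup>2 < \<epsilon>\<^sup>2"
      using M[of "Suc m" "Suc n"] that by (simp add: L2_set_def sum_nonneg)
    then show ?thesis
      using \<open>0 < \<epsilon>\<close> by (simp add: power2_less_imp_less)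
  qed
  then show ?thesis
    using that by blast
qed

section \<open>Heads and tails of finitely supported sequences\<close>

definition head :: "nat \<Rightarrow> (nat \<Rightarrow> real) \<Rightarrow> nat \<Rightarrow> real" where
  "head m x = (\<lambda>j. if j \<le> m then x j else 0)"

definition tail :: "nat \<Rightarrow> (nat \<Rightarrow> real) \<Rightarrow> nat \<Rightarrow> real" where
  "tail m x = (\<lambda>j. if j \<le> m then 0 else x j)"

lemma head_eq: "\<forall>j>m. x j = 0 \<Longrightarrow> head m x = x"
  by (auto simp: head_def fun_eq_iff)

lemma head_tail_zero [simp]: "head m (tail m x) = (\<lambda>_. 0)"
  by (auto simp: head_def tail_def)

lemma tail_tail [simp]: "tail m (tail m x) = tail m x"
  by (auto simp: tail_def)

lemma head_plus_tail: "(\<lambda>j. head m x j + tail m x j) = x"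
  by (auto simp: head_def tail_def)

lemma c00_add: "x \<in> c00 \<Longrightarrow> y \<in> c00 \<Longrightarrow> (\<lambda>j. x j + y j) \<in> c00"
  unfolding c00_iff_bounded_support by (metis add.right_neutral less_trans linorder_neqE_nat)

lemma c00_scale: "x \<in> c00 \<Longrightarrow> (\<lambda>j. a * x j) \<in> c00"
  by (auto simp: c00_iff_bounded_support)

lemma c00_head [simp]: "head m x \<in> c00"
  unfolding c00_iff_bounded_support head_def by (intro exI[of _ m]) auto

lemma c00_tail: "x \<in> c00 \<Longrightarrow> tail m x \<in> c00"
  by (auto simp: c00_iff_bounded_support tail_def)

lemma c00_single [simp]: "(\<lambda>j. if j = k then a else 0) \<in> c00"
  unfolding c00_iff_bounded_support by (intro exI[of _ k]) auto

lemma M_norm_cong: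
  assumes "\<And>j. j \<le> m \<Longrightarrow> x j = y j"
  shows "M_norm N m x = M_norm N m y"
  using assms by (induction m) auto

text \<open>
  After index \<open>m\<close> the recursion sees the first coordinates only through their norm, in an argument
  in which every \<open>N n\<close> is nondecreasing on the nonnegative reals.
\<close>

lemma M_norm_mono_head:
  assumes N: "\<And>n. n \<ge> 1 \<Longrightarrow> absolute_normalized_norm (N n)"
    and "m \<le> n" and "M_norm N m x \<le> M_norm N m y" and "\<And>j. m < j \<Longrightarrow> x j = y j"
  shows "M_norm N n x \<le> M_norm N n y"
  using \<open>m \<le> n\<close>
proof (induction n rule: dec_induct)
  case (step n)
  have "N (Suc n) (M_norm N n x) \<bar>x (Suc n)\<bar> \<le> N (Suc n) (M_norm N n y) \<bar>x (Suc n)\<bar>"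
    using absolute_normalized_norm_mono1[OF N[of "Suc n"] M_norm_nonneg[of N n x, OF N] step.IH]
    by simp
  then show ?case
    using assms(4)[of "Suc n"] step.hyps by simp
qed (rule assms(3))

section \<open>The norm on finitely supported sequences\<close>

locale Xc_space =
  fixes c :: real and J :: "(nat \<Rightarrow> real) \<Rightarrow> 'a::banach"
  assumes c_pos: "0 < c" and c_less_1: "c < 1" and Xc: "is_Xc c J"
begin

abbreviation nrm :: "(nat \<Rightarrow> real) \<Rightarrow> real" where
  "nrm \<equiv> A_norm (Nc c)"

lemma absolute: "n \<ge> 1 \<Longrightarrow> absolute_normalized_norm (Nc c n)"
  using absolute_normalized_norm_Nc c_pos c_less_1 by blast

lemma nrm_eq_M_norm: "\<forall>j>n. x j = 0 \<Longrightarrow> nrm x = M_norm (Nc c) n x"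
  using A_norm_eq_M_norm absolute by blast

lemma nrm_head: "nrm (head m x) = M_norm (Nc c) m x"
  by (subst nrm_eq_M_norm[of m]) (auto simp: head_def intro!: M_norm_cong)

lemma nrm_nonneg [simp]: "0 \<le> nrm x"
  unfolding A_norm_def using M_norm_nonneg absolute by blast

lemma nrm_zero [simp]: "nrm (\<lambda>_. 0) = 0"
  by (simp add: nrm_eq_M_norm[of 0])

lemma nrm_mono_head:
  assumes "x \<in> c00" "y \<in> c00" and "nrm (head m x) \<le> nrm (head m y)" and "tail m x = tail m y"
  shows "nrm x \<le> nrm y"
proof -
  obtain k l where kl: "\<forall>j>k. x j = 0" "\<forall>j>l. y j = 0"
    using assms by (auto simp: c00_iff_bounded_support)
  define n where "n = max m (max k l)"
  have "x j = y j" if "m < j" for j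
    using fun_cong[OF assms(4), of j] that by (simp add: tail_def)
  moreover have "nrm x = M_norm (Nc c) n x" "nrm y = M_norm (Nc c) n y"
    using kl by (auto intro!: nrm_eq_M_norm simp: n_def)
  ultimately show ?thesis
    using M_norm_mono_head[of "Nc c" m n x y, OF absolute] assms(3) by (simp add: nrm_head n_def)
qed

lemma nrm_tail_le:
  assumes "x \<in> c00" shows "nrm (tail m x) \<le> nrm x"
  by (rule nrm_mono_head[of _ _ m]) (use assms in \<open>simp_all add: c00_tail\<close>)

lemma M_norm_pythagoras:
  assumes "m \<le> n"
  shows "(M_norm (Nc c) n x)\<^sup>2 \<le> (M_norm (Nc c) m x)\<^sup>2 + (M_norm (Nc c) n (tail m x))\<^sup>2"
  using assms
proof (induction n rule: dec_induct)
  case (step n)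
  then show ?case
    using Nc_pythagoras[OF c_pos c_less_1 _ step.IH] by (simp add: tail_def)
qed simp

lemma nrm_pythagoras:
  assumes "x \<in> c00"
  shows "(nrm x)\<^sup>2 \<le> (nrm (head m x))\<^sup>2 + (nrm (tail m x))\<^sup>2"
proof -
  obtain k where k: "\<forall>j>k. x j = 0"
    using assms by (auto simp: c00_iff_bounded_support)
  have "nrm x = M_norm (Nc c) (max m k) x" "nrm (tail m x) = M_norm (Nc c) (max m k) (tail m x)"
    using k by (auto intro!: nrm_eq_M_norm simp: tail_def)
  then show ?thesis
    using M_norm_pythagoras[of m "max m k" x] by (simp add: nrm_head)
qed

lemma M_norm_lower: "c\<^sup>2 * (\<Sum>j\<le>n. (x j)\<^sup>2) \<le> (M_norm (Nc c) n x)\<^sup>2"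
proof (induction n)
  case 0
  have "c\<^sup>2 \<le> 1"
    using c_pos c_less_1 by (simp add: power_le_one)
  then show ?case
    using mult_right_mono[of "c\<^sup>2" 1 "(x 0)\<^sup>2"] by simp
next
  case (Suc n)
  then show ?case
    using Nc_lower[OF c_pos c_less_1, of "Suc n" "M_norm (Nc c) n x" "\<bar>x (Suc n)\<bar>"]
    by (simp add: algebra_simps)
qed

lemma M_norm_upper: "(M_norm (Nc c) n x)\<^sup>2 \<le> (\<Sum>j\<le>n. (x j)\<^sup>2)"
proof (induction n)
  case (Suc n)
  have "Nc c (Suc n) 0 \<bar>x (Suc n)\<bar> = \<bar>x (Suc n)\<bar>"
    using absolute_normalized_norm_axis[OF absolute_normalized_norm_swap[OF absolute[of "Suc n"]]]
    by simp
  then show ?case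
    using Suc Nc_pythagoras[OF c_pos c_less_1, of "Suc n" "M_norm (Nc c) n x"
        "M_norm (Nc c) n x" 0 "\<bar>x (Suc n)\<bar>"]
    by simp
qed simp

lemma nrm_lower: "c * L2_set x {..n} \<le> nrm (head n x)"
proof (rule power2_le_imp_le)
  show "(c * L2_set x {..n})\<^sup>2 \<le> (nrm (head n x))\<^sup>2"
    using M_norm_lower[of x n] by (simp add: nrm_head L2_set_def power_mult_distrib sum_nonneg)
qed simp

lemma nrm_upper: "nrm (head n x) \<le> L2_set x {..n}"
proof (rule power2_le_imp_le)
  show "(nrm (head n x))\<^sup>2 \<le> (L2_set x {..n})\<^sup>2"
    using M_norm_upper[of n x] by (simp add: nrm_head L2_set_def sum_nonneg)
qed simp

lemma nrm_head_le:
  assumes "x \<in> c00" shows "nrm (head m x) \<le> nrm x"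
proof -
  obtain k where k: "\<forall>j>k. x j = 0"
    using assms by (auto simp: c00_iff_bounded_support)
  have "M_norm (Nc c) m x \<le> M_norm (Nc c) n x" if "m \<le> n" for n
    using that
  proof (induction n rule: dec_induct)
    case (step n)
    have "M_norm (Nc c) n x \<le> M_norm (Nc c) (Suc n) x"
      using absolute_normalized_norm_mono[OF absolute[of "Suc n"], of "M_norm (Nc c) n x"
          "M_norm (Nc c) n x" 0 "\<bar>x (Suc n)\<bar>"]
        absolute_normalized_norm_axis[OF absolute[of "Suc n"]] M_norm_nonneg[of "Nc c" n x, OF absolute]
      by simp
    then show ?case
      using step.IH by simp
  qed simp
  then show ?thesis
    using k nrm_eq_M_norm[of "max m k" x] by (simp add: nrm_head)
qed

lemma L2_set_le_nrm:
  assumes "x \<in> c00" "finite S"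
  shows "c * L2_set x S \<le> nrm x"
proof -
  obtain k where k: "\<forall>j>k. x j = 0"
    using assms by (auto simp: c00_iff_bounded_support)
  obtain s where s: "S \<subseteq> {..s}"
    using assms(2) finite_nat_iff_bounded_le by auto
  have "L2_set x S \<le> L2_set x {..max s k}"
    unfolding L2_set_def using s by (intro real_sqrt_le_mono sum_mono2) auto
  then have "c * L2_set x S \<le> c * L2_set x {..max s k}"
    using c_pos by simp
  also have "\<dots> \<le> nrm x"
    using nrm_lower[of x "max s k"] k by (simp add: head_eq)
  finally show ?thesis .
qed

section \<open>Functionals on the completion\<close>

lemma J_add: "x \<in> c00 \<Longrightarrow> y \<in> c00 \<Longrightarrow> J (\<lambda>j. x j + y j) = J x + J y"
  and J_scale: "x \<in> c00 \<Longrightarrow> J (\<lambda>j. a * x j) = a *\<^sub>R J x"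
  and norm_J: "x \<in> c00 \<Longrightarrow> norm (J x) = nrm x"
  and J_dense: "closure (J ` c00) = UNIV"
  using Xc by (auto simp: is_Xc_def is_A_completion_def)

lemma nrm_scale: "x \<in> c00 \<Longrightarrow> nrm (\<lambda>j. a * x j) = \<bar>a\<bar> * nrm x"
  using norm_J[OF c00_scale] norm_J J_scale by (metis norm_scaleR)

definition e :: "nat \<Rightarrow> 'a" where
  "e k = J (\<lambda>j. if j = k then 1 else 0)"

lemma J_zero: "J (\<lambda>_. 0) = 0"
  using J_scale[of "\<lambda>_. 0" 0] by (simp add: c00_def)

lemma J_head: "J (head m x) = (\<Sum>j\<le>m. x j *\<^sub>R e j)"
proof (induction m)
  case 0
  have "head 0 x = (\<lambda>j. x 0 * (if j = 0 then 1 else 0))"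
    by (auto simp: head_def)
  then show ?case
    using J_scale[of "\<lambda>j. if j = 0 then 1 else 0" "x 0"] by (simp add: e_def)
next
  case (Suc m)
  have "head (Suc m) x = (\<lambda>j. head m x j + x (Suc m) * (if j = Suc m then 1 else 0))"
    by (auto simp: head_def fun_eq_iff le_Suc_eq)
  then show ?case
    using J_scale[of "\<lambda>j. if j = Suc m then 1 else 0" "x (Suc m)"] Suc
    by (simp add: e_def J_add c00_scale)
qed

lemma J_eq_sum: "\<forall>j>n. x j = 0 \<Longrightarrow> J x = (\<Sum>j\<le>n. x j *\<^sub>R e j)"
  using J_head[of n x] by (simp add: head_eq)

lemma J_split: "x \<in> c00 \<Longrightarrow> J x = J (head m x) + J (tail m x)"
  using J_add[of "head m x" "tail m x"] by (simp add: c00_tail head_plus_tail)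

lemma norm_e_le: "norm (e k) \<le> 1"
proof -
  let ?d = "\<lambda>j. if j = k then 1 else 0 :: real"
  have "head k ?d = ?d"
    by (auto simp: head_def)
  moreover have "(\<Sum>j\<le>k. (if j = k then 1 else 0 :: real)\<^sup>2) = (\<Sum>j\<le>k. if j = k then 1 else 0)"
    by (intro sum.cong) auto
  ultimately show ?thesis
    using nrm_upper[of k ?d] norm_J[of ?d] by (simp add: e_def L2_set_def)
qed

lemma norm_le_on_c00:
  fixes f :: "'a \<Rightarrow>\<^sub>L real"
  assumes "0 \<le> C" "\<And>x. x \<in> c00 \<Longrightarrow> f (J x) \<le> C * nrm x"
  shows "norm f \<le> C"
proof (rule norm_blinfun_bound[OF \<open>0 \<le> C\<close>])
  fix z
  have abs: "\<bar>f (J x)\<bar> \<le> C * nrm x" if "x \<in> c00" for x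
    using assms(2)[OF that] assms(2)[OF c00_scale[OF that], of "-1"] J_scale[OF that, of "-1"]
      norm_J[OF that] norm_J[OF c00_scale[OF that], of "-1"]
    by (simp add: blinfun.minus_right abs_le_iff)
  have "closed {z. norm (f z) \<le> C * norm z}"
    by (intro closed_Collect_le continuous_intros)
  then have "closure (J ` c00) \<subseteq> {z. norm (f z) \<le> C * norm z}"
    by (intro closure_minimal) (auto simp: norm_J abs)
  then show "norm (f z) \<le> C * norm z"
    using J_dense by auto
qed

lemma apply_le: "x \<in> c00 \<Longrightarrow> blinfun_apply f (J x) \<le> norm (f :: 'a \<Rightarrow>\<^sub>L real) * nrm x"
  using norm_blinfun[of f "J x"] by (simp add: norm_J)

text \<open>
  A bounded linear functional on \<open>c\<^sub>0\<^sub>0\<close> is Lipschitz on a dense subset of the completion; the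
  continuous extension is linear because linearity is a closed condition.
\<close>

lemma extend_functional:
  assumes add: "\<And>x y. x \<in> c00 \<Longrightarrow> y \<in> c00 \<Longrightarrow> l (\<lambda>j. x j + y j) = l x + (l y :: real)"
    and scale: "\<And>x a. x \<in> c00 \<Longrightarrow> l (\<lambda>j. a * x j) = a * l x"
    and bound: "\<And>x. x \<in> c00 \<Longrightarrow> \<bar>l x\<bar> \<le> C * nrm x"
  obtains f :: "'a \<Rightarrow>\<^sub>L real" where "\<And>x. x \<in> c00 \<Longrightarrow> f (J x) = l x"
proof -
  have diff: "l x - l y = l (\<lambda>j. x j + - 1 * y j)" "J (\<lambda>j. x j + - 1 * y j) = J x - J y"
    if "x \<in> c00" "y \<in> c00" for x y
    using add[OF that(1) c00_scale[OF that(2)], of "-1"] scale[OF that(2), of "-1"]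
      J_add[OF that(1) c00_scale[OF that(2)], of "-1"] J_scale[OF that(2), of "-1"] by auto
  have lip: "\<bar>l x - l y\<bar> \<le> \<bar>C\<bar> * norm (J x - J y)" if "x \<in> c00" "y \<in> c00" for x y
  proof -
    have mem: "(\<lambda>j. x j + - 1 * y j) \<in> c00"
      using that by (intro c00_add c00_scale)
    have "\<bar>l x - l y\<bar> \<le> C * nrm (\<lambda>j. x j + - 1 * y j)"
      using bound[OF mem] diff[OF that] by simp
    also have "\<dots> \<le> \<bar>C\<bar> * nrm (\<lambda>j. x j + - 1 * y j)"
      by (intro mult_right_mono) auto
    finally show ?thesis
      using norm_J[OF mem] diff[OF that] by simp
  qed
  \<comment> \<open>Any preimage will do: by \<open>lip\<close>, \<open>l\<close> takes the same value on all of them.\<close>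
  define h where "h z = l (SOME x. x \<in> c00 \<and> J x = z)" for z
  have h: "h (J x) = l x" if "x \<in> c00" for x
  proof -
    have "(SOME y. y \<in> c00 \<and> J y = J x) \<in> c00 \<and> J (SOME y. y \<in> c00 \<and> J y = J x) = J x"
      by (rule someI[of _ x]) (use that in auto)
    then show ?thesis
      using lip[OF _ that] by (force simp: h_def)
  qed
  have "\<bar>C\<bar>-lipschitz_on (J ` c00) h"
    using lip by (auto simp: lipschitz_on_def dist_norm h)
  then obtain g where g: "\<bar>C\<bar>-lipschitz_on UNIV g" "\<And>z. z \<in> J ` c00 \<Longrightarrow> g z = h z"
    using lipschitz_extend_closure J_dense by metis
  have gJ: "g (J x) = l x" if "x \<in> c00" for x
    using g(2) h that by auto
  have cont: "continuous_on UNIV g"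
    using g(1) lipschitz_on_continuous_on by blast
  have cont_comp: "continuous_on S (\<lambda>z. g (k z))" if "continuous_on S k"
    for S :: "'z::topological_space set" and k
    using continuous_on_compose2[OF cont that] by simp
  have add_dense: "closure (J ` c00 \<times> J ` c00) \<subseteq> {p. g (fst p + snd p) = g (fst p) + g (snd p)}"
  proof (intro closure_minimal closed_Collect_eq cont_comp continuous_intros subsetI)
    fix p assume "p \<in> J ` c00 \<times> J ` c00"
    then obtain x y where xy: "p = (J x, J y)" "x \<in> c00" "y \<in> c00"
      by auto
    then show "p \<in> {p. g (fst p + snd p) = g (fst p) + g (snd p)}"
      using gJ[OF c00_add[OF xy(2,3)]] by (simp add: gJ add J_add)
  qed
  have g_add: "g (u + v) = g u + g v" for u v
    using subsetD[OF add_dense, of "(u, v)"] by (simp add: closure_Times J_dense)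
  have "closure (J ` c00) \<subseteq> {z. g (a *\<^sub>R z) = a *\<^sub>R g z}" for a
  proof (intro closure_minimal closed_Collect_eq cont_comp continuous_intros subsetI)
    fix p assume "p \<in> J ` c00"
    then obtain x where x: "p = J x" "x \<in> c00"
      by auto
    then show "p \<in> {z. g (a *\<^sub>R z) = a *\<^sub>R g z}"
      using gJ[OF c00_scale[OF x(2)], of a] by (simp add: gJ scale J_scale)
  qed
  then have g_scale: "g (a *\<^sub>R z) = a *\<^sub>R g z" for a z
    using J_dense by auto
  have "g 0 = 0"
    using g_scale[of 0 0] by simp
  then have "norm (g z) \<le> norm z * \<bar>C\<bar>" for z
    using lipschitz_onD[OF g(1), of z 0] by (simp add: dist_norm mult.commute)
  then have "bounded_linear g"
    by (intro bounded_linear_intro[of g "\<bar>C\<bar>"] g_add g_scale)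
  then show ?thesis
    using gJ by (intro that[of "Blinfun g"]) (simp add: bounded_linear_Blinfun_apply)
qed

section \<open>Truncations of functionals\<close>

definition coord :: "nat \<Rightarrow> 'a \<Rightarrow>\<^sub>L real" where
  "coord k = (SOME f. \<forall>x\<in>c00. blinfun_apply f (J x) = x k)"

lemma coord_J:
  assumes "x \<in> c00" shows "coord k (J x) = x k"
proof -
  have "\<bar>y k\<bar> \<le> (1 / c) * nrm y" if "y \<in> c00" for y
    using L2_set_le_nrm[OF that, of "{k}"] c_pos by (simp add: field_simps)
  then obtain f :: "'a \<Rightarrow>\<^sub>L real" where "\<And>y. y \<in> c00 \<Longrightarrow> f (J y) = y k"
    using extend_functional[of "\<lambda>y. y k" "1 / c"] by auto
  then have "\<forall>y\<in>c00. blinfun_apply (coord k) (J y) = y k"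
    unfolding coord_def
    using someI[of "\<lambda>g. \<forall>y\<in>c00. blinfun_apply g (J y) = y k" f] by blast
  then show ?thesis
    using assms by blast
qed

definition trunc :: "nat \<Rightarrow> ('a \<Rightarrow>\<^sub>L real) \<Rightarrow> ('a \<Rightarrow>\<^sub>L real)" where
  "trunc m f = (\<Sum>j\<le>m. f (e j) *\<^sub>R coord j)"

lemma trunc_J:
  assumes "x \<in> c00" shows "trunc m f (J x) = f (J (head m x))"
proof -
  have "trunc m f (J x) = (\<Sum>j\<le>m. f (e j) * x j)"
    using assms by (simp add: trunc_def coord_J blinfun.sum_left blinfun.scaleR_left)
  also have "\<dots> = f (J (head m x))"
    by (simp add: J_head blinfun.sum_right blinfun.scaleR_right mult.commute)
  finally show ?thesis .
qed

lemma trunc_compl_J: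
  assumes "x \<in> c00" shows "(f - trunc m f) (J x) = f (J (tail m x))"
  using trunc_J[OF assms, of m f] J_split[OF assms, of m]
  by (simp add: blinfun.diff_left blinfun.add_right)

lemma trunc_add: "trunc m (f + g) = trunc m f + trunc m g"
  by (simp add: trunc_def blinfun.add_left scaleR_add_left sum.distrib)

text \<open>
  By density, the norm of a functional is a supremum over finitely supported vectors.
\<close>

lemma norm_approx:
  fixes f :: "'a \<Rightarrow>\<^sub>L real"
  assumes "r < norm f"
  obtains x where "x \<in> c00" "nrm x \<le> 1" "r < f (J x)"
proof (cases "r < 0")
  case True
  then show ?thesis
    by (intro that[of "\<lambda>_. 0"]) (auto simp: c00_def J_zero)
next
  case False
  then obtain x where x: "x \<in> c00" "r * nrm x < f (J x)"
    using norm_le_on_c00[of r f] assms by (meson not_le)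
  have pos: "0 < nrm x"
  proof (rule ccontr)
    assume "\<not> 0 < nrm x"
    then have "nrm x = 0"
      using nrm_nonneg[of x] by linarith
    then show False
      using x norm_J[OF x(1)] by simp
  qed
  show ?thesis
  proof (rule that)
    show "(\<lambda>j. (1 / nrm x) * x j) \<in> c00"
      by (rule c00_scale[OF x(1)])
    show "nrm (\<lambda>j. (1 / nrm x) * x j) \<le> 1"
      using pos by (subst nrm_scale[OF x(1)]) simp
    show "r < f (J (\<lambda>j. (1 / nrm x) * x j))"
      using x pos by (subst J_scale[OF x(1)]) (simp add: blinfun.scaleR_right field_simps)
  qed
qed

lemma head_tail_combine:
  fixes a b m x y
  defines "w \<equiv> (\<lambda>j. a * head m x j + b * tail m y j)"
  assumes "x \<in> c00" "y \<in> c00"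
  shows "w \<in> c00" "head m w = (\<lambda>j. a * head m x j)" "tail m w = (\<lambda>j. b * tail m y j)"
  using assms by (auto simp: head_def tail_def fun_eq_iff intro!: c00_add c00_scale c00_head c00_tail)
    (auto simp: c00_iff_bounded_support)

text \<open>
  Let \<open>\<alpha>\<close> and \<open>\<beta>\<close> be the norms of the two parts of \<open>f\<close>, almost attained by a head \<open>x\<close> and a
  tail \<open>y\<close> in the unit ball.  On \<open>\<alpha> x + \<beta> y\<close>, whose norm is at most \<open>\<surd>(\<alpha>\<^sup>2 + \<beta>\<^sup>2)\<close>, the
  functional \<open>f\<close> takes almost the value \<open>\<alpha>\<^sup>2 + \<beta>\<^sup>2\<close>.
\<close>

lemma dual_pythagoras: "(norm (trunc m f))\<^sup>2 + (norm (f - trunc m f))\<^sup>2 \<le> (norm f)\<^sup>2"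
proof -
  define \<alpha> where "\<alpha> = norm (trunc m f)"
  define \<beta> where "\<beta> = norm (f - trunc m f)"
  define D where "D = norm f * sqrt (\<alpha>\<^sup>2 + \<beta>\<^sup>2)"
  have nn: "\<alpha> \<ge> 0" "\<beta> \<ge> 0"
    by (auto simp: \<alpha>_def \<beta>_def)
  have "\<alpha> * \<alpha> + \<beta> * \<beta> \<le> D + \<eta>" if "0 < \<eta>" for \<eta>
  proof -
    obtain \<delta> where "0 < \<delta>" and "(\<alpha> + \<beta>) * \<delta> \<le> \<eta>"
      by (rule exists_small_multiple[of "\<alpha> + \<beta>" \<eta>]) (use nn \<open>0 < \<eta>\<close> in auto)
    then have \<delta>: "\<alpha> * \<delta> + \<beta> * \<delta> \<le> \<eta>"
      by (simp add: distrib_right)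
    obtain x where x: "x \<in> c00" "nrm x \<le> 1" "\<alpha> - \<delta> < trunc m f (J x)"
      using norm_approx[of "\<alpha> - \<delta>" "trunc m f"] \<open>0 < \<delta>\<close> by (auto simp: \<alpha>_def)
    obtain y where y: "y \<in> c00" "nrm y \<le> 1" "\<beta> - \<delta> < (f - trunc m f) (J y)"
      using norm_approx[of "\<beta> - \<delta>" "f - trunc m f"] \<open>0 < \<delta>\<close> by (auto simp: \<beta>_def)
    define w where "w = (\<lambda>j. \<alpha> * head m x j + \<beta> * tail m y j)"
    note w = head_tail_combine[OF x(1) y(1), where a = \<alpha> and b = \<beta> and m = m, folded w_def]
    have "(nrm w)\<^sup>2 \<le> (\<alpha> * nrm (head m x))\<^sup>2 + (\<beta> * nrm (tail m y))\<^sup>2"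
      using nrm_pythagoras[OF w(1), of m] nn
      by (simp add: w nrm_scale c00_tail y(1))
    also have "\<dots> \<le> (\<alpha> * 1)\<^sup>2 + (\<beta> * 1)\<^sup>2"
      using nn nrm_head_le[OF x(1), of m] nrm_tail_le[OF y(1), of m] x(2) y(2)
      by (intro add_mono power_mono mult_left_mono) auto
    finally have "nrm w \<le> sqrt (\<alpha>\<^sup>2 + \<beta>\<^sup>2)"
      by (simp add: real_le_rsqrt)
    then have "norm f * nrm w \<le> D"
      by (simp add: D_def mult_left_mono)
    moreover have "f (J w) = \<alpha> * trunc m f (J x) + \<beta> * (f - trunc m f) (J y)"
      using J_split[OF w(1), of m] x y
      by (simp only: w J_scale c00_head c00_tail trunc_J trunc_compl_J blinfun.add_right
          blinfun.scaleR_right real_scaleR_def)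
    moreover have "\<alpha> * (\<alpha> - \<delta>) + \<beta> * (\<beta> - \<delta>) \<le> \<alpha> * trunc m f (J x) + \<beta> * (f - trunc m f) (J y)"
      using nn x y by (intro add_mono mult_left_mono) auto
    ultimately have "\<alpha> * (\<alpha> - \<delta>) + \<beta> * (\<beta> - \<delta>) \<le> D"
      using apply_le[OF w(1), of f] by linarith
    then show ?thesis
      using \<delta> by (simp add: right_diff_distrib)
  qed
  then have le: "\<alpha>\<^sup>2 + \<beta>\<^sup>2 \<le> D"
    unfolding power2_eq_square by (rule field_le_epsilon)
  define r where "r = sqrt (\<alpha>\<^sup>2 + \<beta>\<^sup>2)"
  have r: "r\<^sup>2 = \<alpha>\<^sup>2 + \<beta>\<^sup>2" "r \<ge> 0"
    by (auto simp: r_def)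
  then have "r * r \<le> norm f * r"
    using le by (simp add: D_def r_def power2_eq_square)
  then have "r \<le> norm f"
    by (rule mult_self_le_imp_le) (use r(2) in auto)
  then have "r\<^sup>2 \<le> (norm f)\<^sup>2"
    using r(2) by (intro power_mono)
  then show ?thesis
    using r by (simp add: \<alpha>_def \<beta>_def)
qed

text \<open>
  Given a test vector \<open>x\<close>, replace its head by a vector of at most the same norm on which
  \<open>trunc m f'\<close> nearly attains its norm: the norm of the test vector does not grow, and the value
  of the functional drops by an arbitrarily small amount at most.
\<close>

lemma dual_mono_head:
  assumes "norm (trunc m f) \<le> norm (trunc m f')"
  shows "norm (trunc m f + (g - trunc m g)) \<le> norm (trunc m f' + (g - trunc m g))"
proof (rule norm_le_on_c00)
  fix x assume x: "x \<in> c00"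
  define s where "s = nrm (head m x)"
  let ?h = "trunc m f' + (g - trunc m g)"
  show "(trunc m f + (g - trunc m g)) (J x) \<le> norm ?h * nrm x"
  proof (rule field_le_epsilon)
    fix \<eta> :: real assume "0 < \<eta>"
    obtain \<delta> where \<delta>: "0 < \<delta>" "s * \<delta> \<le> \<eta>"
      by (rule exists_small_multiple[of s \<eta>]) (use \<open>0 < \<eta>\<close> in \<open>auto simp: s_def\<close>)
    obtain y where y: "y \<in> c00" "nrm y \<le> 1" "norm (trunc m f') - \<delta> < trunc m f' (J y)"
      using norm_approx[of "norm (trunc m f') - \<delta>" "trunc m f'"] \<open>0 < \<delta>\<close> by auto
    define w where "w = (\<lambda>j. s * head m y j + 1 * tail m x j)"
    note w = head_tail_combine[OF y(1) x, where a = s and b = 1 and m = m, folded w_def]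
    have "nrm (head m w) = s * nrm (head m y)"
      by (simp add: w nrm_scale s_def)
    also have "\<dots> \<le> s * 1"
      using nrm_head_le[OF y(1), of m] y(2) by (intro mult_left_mono) (auto simp: s_def)
    finally have "nrm w \<le> nrm x"
      using w by (intro nrm_mono_head[of w x m] x) (auto simp: s_def)
    have "trunc m f (J x) = trunc m f (J (head m x))"
      using x by (simp add: trunc_J) (simp add: head_def cong: if_cong)
    also have "\<dots> \<le> norm (trunc m f) * s"
      unfolding s_def by (rule apply_le) simp
    also have "\<dots> \<le> norm (trunc m f') * s"
      using assms by (intro mult_right_mono) (auto simp: s_def)
    also have "\<dots> \<le> (trunc m f' (J y) + \<delta>) * s"
      using y by (intro mult_right_mono) (auto simp: s_def)
    also have "\<dots> \<le> s * trunc m f' (J y) + \<eta>"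
      using \<delta> by (simp add: algebra_simps)
    finally have 1: "trunc m f (J x) \<le> s * trunc m f' (J y) + \<eta>" .
    have "?h (J w) = s * trunc m f' (J y) + (g - trunc m g) (J x)"
      unfolding blinfun.add_left
      by (subst trunc_J[OF w(1)], subst trunc_compl_J[OF w(1)], unfold w(2,3))
        (simp add: J_scale y trunc_J trunc_compl_J x blinfun.scaleR_right)
    moreover have "?h (J w) \<le> norm ?h * nrm w"
      by (rule apply_le[OF w(1)])
    moreover have "norm ?h * nrm w \<le> norm ?h * nrm x"
      using \<open>nrm w \<le> nrm x\<close> by (intro mult_left_mono) auto
    ultimately show "(trunc m f + (g - trunc m g)) (J x) \<le> norm ?h * nrm x + \<eta>"
      using 1 by (simp add: blinfun.add_left)
  qed
qed simp

text \<open>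
  The lower \<open>\<ell>\<^sub>2\<close>-estimate on \<open>X\<close> is, dually, an upper \<open>\<ell>\<^sub>2\<close>-estimate for functionals.
\<close>

lemma norm_sum_coord_le:
  assumes "finite S"
  shows "norm (\<Sum>j\<in>S. b j *\<^sub>R coord j) \<le> L2_set b S / c"
proof (rule norm_le_on_c00)
  show "0 \<le> L2_set b S / c"
    using c_pos by simp
  fix x assume x: "x \<in> c00"
  have "(\<Sum>j\<in>S. b j *\<^sub>R coord j) (J x) = (\<Sum>j\<in>S. b j * x j)"
    using x by (simp add: blinfun.sum_left blinfun.scaleR_left coord_J)
  also have "\<dots> \<le> (\<Sum>j\<in>S. \<bar>b j\<bar> * \<bar>x j\<bar>)"
    by (intro sum_mono) (simp flip: abs_mult)
  also have "\<dots> \<le> L2_set b S * L2_set x S"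
    by (rule L2_set_mult_ineq)
  also have "\<dots> \<le> L2_set b S * (nrm x / c)"
    using L2_set_le_nrm[OF x assms] c_pos
    by (intro mult_left_mono) (auto simp: field_simps)
  finally show "(\<Sum>j\<in>S. b j *\<^sub>R coord j) (J x) \<le> L2_set b S / c * nrm x"
    by simp
qed

text \<open>
  Test \<open>f\<close> on the vector whose coordinates are its own first coefficients.
\<close>

lemma L2_set_coeff_le: "L2_set (\<lambda>j. blinfun_apply f (e j)) {..m} \<le> norm f"
proof -
  define b where "b = (\<lambda>j. blinfun_apply f (e j))"
  have "(L2_set b {..m})\<^sup>2 = f (J (head m b))"
    by (simp add: J_head blinfun.sum_right blinfun.scaleR_right L2_set_def sum_nonneg b_def
        power2_eq_square)
  also have "\<dots> \<le> norm f * nrm (head m b)"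
    by (rule apply_le) simp
  also have "\<dots> \<le> norm f * L2_set b {..m}"
    using nrm_upper by (intro mult_left_mono) auto
  finally show ?thesis
    unfolding b_def power2_eq_square by (rule mult_self_le_imp_le) simp_all
qed

text \<open>
  On a vector supported on \<open>{0..n}\<close> the functional \<open>f\<close> agrees with \<open>trunc n f\<close>, so a bound for
  \<open>trunc n f - trunc m f\<close> that is uniform in \<open>n\<close> is one for \<open>f - trunc m f\<close>.
\<close>

lemma trunc_tendsto: "(\<lambda>m. trunc m f) \<longlonglongrightarrow> f"
proof (rule LIMSEQ_I)
  fix r :: real assume "0 < r"
  define b where "b = (\<lambda>j. blinfun_apply f (e j))"
  obtain M where M: "\<And>m n. M \<le> m \<Longrightarrow> L2_set b {m<..n} < c * r / 2"
    using L2_set_tail_small[of b "norm f" "c * r / 2"] L2_set_coeff_le[of f] \<open>0 < r\<close> c_pos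
    by (auto simp: b_def)
  have "norm (f - trunc m f) \<le> r / 2" if "M \<le> m" for m
  proof (rule norm_le_on_c00)
    fix x assume x: "x \<in> c00"
    obtain k where k: "\<forall>j>k. x j = 0"
      using x by (auto simp: c00_iff_bounded_support)
    define n where "n = max m k"
    have "{..n} = {..m} \<union> {m<..n}"
      by (auto simp: n_def)
    then have "trunc n f = trunc m f + (\<Sum>j\<in>{m<..n}. b j *\<^sub>R coord j)"
      unfolding trunc_def b_def by (subst sum.union_disjoint[symmetric]) auto
    then have "norm (trunc n f - trunc m f) \<le> L2_set b {m<..n} / c"
      using norm_sum_coord_le[of "{m<..n}" b] by simp
    also have "\<dots> \<le> r / 2"
      using M[OF that, of n] c_pos by (simp add: field_simps)
    finally have le: "norm (trunc n f - trunc m f) \<le> r / 2" .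
    have "(f - trunc m f) (J x) = (trunc n f - trunc m f) (J x)"
      using trunc_J[OF x, of n f] k by (simp add: blinfun.diff_left head_eq n_def)
    also have "\<dots> \<le> norm (trunc n f - trunc m f) * nrm x"
      by (rule apply_le[OF x])
    also have "\<dots> \<le> r / 2 * nrm x"
      using le by (intro mult_right_mono) auto
    finally show "(f - trunc m f) (J x) \<le> r / 2 * nrm x" .
  qed (use \<open>0 < r\<close> in simp)
  then show "\<exists>M. \<forall>m\<ge>M. norm (trunc m f - f) < r"
    using \<open>0 < r\<close> by (intro exI[of _ M]) (force simp: norm_minus_commute)
qed

section \<open>Reflexivity and weak limits\<close>

text \<open>
  The values \<open>b\<^sub>j\<close> of \<open>\<phi>\<close> on the coordinate functionals are square summable, so the partial sums
  of \<open>\<Sum>\<^sub>j b\<^sub>j e\<^sub>j\<close> are Cauchy.  Their limit represents \<open>\<phi>\<close> on all truncations, and these converge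
  in norm.
\<close>

lemma reflexive:
  fixes \<phi> :: "('a \<Rightarrow>\<^sub>L real) \<Rightarrow>\<^sub>L real"
  obtains z where "\<And>h. \<phi> h = h z"
proof -
  define b where "b = (\<lambda>j. \<phi> (coord j))"
  define z where "z k = J (head k b)" for k
  have "L2_set b {..m} \<le> norm \<phi> / c" for m
  proof -
    have "(L2_set b {..m})\<^sup>2 = \<phi> (\<Sum>j\<le>m. b j *\<^sub>R coord j)"
      by (simp add: blinfun.sum_right blinfun.scaleR_right L2_set_def sum_nonneg b_def
          power2_eq_square)
    also have "\<dots> \<le> norm \<phi> * norm (\<Sum>j\<le>m. b j *\<^sub>R coord j)"
      using norm_blinfun[of \<phi> "\<Sum>j\<le>m. b j *\<^sub>R coord j"] by simp
    also have "\<dots> \<le> norm \<phi> * (L2_set b {..m} / c)"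
      by (intro mult_left_mono norm_sum_coord_le) auto
    also have "\<dots> = norm \<phi> / c * L2_set b {..m}"
      by simp
    finally have "L2_set b {..m} * L2_set b {..m} \<le> norm \<phi> / c * L2_set b {..m}"
      by (simp only: power2_eq_square)
    then show ?thesis
      by (rule mult_self_le_imp_le) (use c_pos in simp_all)
  qed
  note bound = this
  have diff: "norm (z n - z m) \<le> L2_set b {m<..n}" if "m \<le> n" for m n
  proof -
    have "head m (head n b) = head m b"
      using that by (auto simp: head_def)
    then have "z n - z m = J (tail m (head n b))"
      using J_split[of "head n b" m] by (simp add: z_def)
    also have "tail m (head n b) = head n (tail m b)"
      by (auto simp: head_def tail_def)
    finally have "norm (z n - z m) \<le> L2_set (tail m b) {..n}"
      by (simp add: norm_J nrm_upper)
    also have "\<dots> = L2_set b {m<..n}"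
      unfolding L2_set_def
      by (intro arg_cong[of _ _ sqrt] sum.mono_neutral_cong_right) (auto simp: tail_def)
    finally show ?thesis .
  qed
  have "Cauchy z"
    proof (rule CauchyI)
    fix \<eta> :: real assume "0 < \<eta>"
    with bound obtain M where M: "\<And>m n. M \<le> m \<Longrightarrow> L2_set b {m<..n} < \<eta>"
      using L2_set_tail_small by blast
    show "\<exists>M. \<forall>m\<ge>M. \<forall>n\<ge>M. norm (z m - z n) < \<eta>"
    proof (intro exI[of _ M] allI impI)
      fix m n assume "M \<le> m" "M \<le> n"
      then show "norm (z m - z n) < \<eta>"
        using diff[of m n] diff[of n m] M[of m n] M[of n m]
        by (cases "m \<le> n") (auto simp: norm_minus_commute)
    qed
  qed
  then obtain L where L: "z \<longlonglongrightarrow> L"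
    using Cauchy_convergent_iff convergent_def by blast
  show ?thesis
  proof (rule that)
    fix h :: "'a \<Rightarrow>\<^sub>L real"
    have "(\<lambda>k. h (z k)) \<longlonglongrightarrow> h L"
      by (rule blinfun.tendsto[OF tendsto_const L])
    moreover have "h (z k) = \<phi> (trunc k h)" for k
      by (simp add: z_def J_head trunc_def b_def blinfun.sum_right blinfun.scaleR_right mult.commute)
    moreover have "(\<lambda>k. \<phi> (trunc k h)) \<longlonglongrightarrow> \<phi> h"
      by (rule blinfun.tendsto[OF tendsto_const trunc_tendsto])
    ultimately show "\<phi> h = h L"
      using LIMSEQ_unique by auto
  qed
qed

text \<open>
  By reflexivity, weak and weak-star convergence to \<open>0\<close> agree.
\<close>

lemma weakly_null_iff: "weakly_null g \<longleftrightarrow> (\<forall>z. (\<lambda>n. blinfun_apply (g n) z) \<longlonglongrightarrow> 0)"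
  for g :: "nat \<Rightarrow> 'a \<Rightarrow>\<^sub>L real"
proof
  assume g: "weakly_null g"
  show "\<forall>z. (\<lambda>n. blinfun_apply (g n) z) \<longlonglongrightarrow> 0"
  proof
    fix z
    have "blinfun_apply (Blinfun (\<lambda>h :: 'a \<Rightarrow>\<^sub>L real. blinfun_apply h z)) = (\<lambda>h. blinfun_apply h z)"
      by (intro bounded_linear_Blinfun_apply blinfun.bounded_linear_left)
    then show "(\<lambda>n. blinfun_apply (g n) z) \<longlonglongrightarrow> 0"
      using g[unfolded weakly_null_def, rule_format, of "Blinfun (\<lambda>h. blinfun_apply h z)"] by simp
  qed
next
  assume g: "\<forall>z. (\<lambda>n. blinfun_apply (g n) z) \<longlonglongrightarrow> 0"
  show "weakly_null g"
    unfolding weakly_null_def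
  proof
    fix \<phi> :: "('a \<Rightarrow>\<^sub>L real) \<Rightarrow>\<^sub>L real"
    obtain z where "\<And>h. \<phi> h = h z"
      using reflexive by blast
    then show "(\<lambda>n. \<phi> (g n)) \<longlonglongrightarrow> 0"
      using g by simp
  qed
qed

text \<open>
  A diagonal subsequence converges at every basis vector, hence on \<open>c\<^sub>0\<^sub>0\<close>, and, being bounded,
  everywhere.
\<close>

lemma weak_limit_subseq:
  fixes f :: "nat \<Rightarrow> 'a \<Rightarrow>\<^sub>L real"
  assumes bound: "\<And>n. norm (f n) \<le> C"
  obtains r h where "strict_mono (r :: nat \<Rightarrow> nat)" "weakly_null (\<lambda>n. f (r n) - h)"
proof -
  have coeff: "norm (f n (e k)) \<le> C" for n k
  proof -
    have "norm (f n (e k)) \<le> norm (f n) * norm (e k)"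
      by (rule norm_blinfun)
    also have "\<dots> \<le> norm (f n) * 1"
      using norm_e_le by (intro mult_left_mono) auto
    finally show ?thesis
      using bound[of n] by simp
  qed
  obtain r where r: "strict_mono (r :: nat \<Rightarrow> nat)"
    and "\<And>k. \<exists>l. (\<lambda>n. f (r n) (e k)) \<longlonglongrightarrow> l"
    by (rule function_convergent_subsequence[of "UNIV :: nat set" "\<lambda>n k. f n (e k)" C]) (use coeff in auto)
  then obtain a where a: "\<And>k. (\<lambda>n. f (r n) (e k)) \<longlonglongrightarrow> a k"
    by metis
  define l where "l x = lim (\<lambda>n. f (r n) (J x))" for x
  have l: "(\<lambda>n. f (r n) (J x)) \<longlonglongrightarrow> l x" if x: "x \<in> c00" for x
  proof -
    obtain k where "\<forall>j>k. x j = 0"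
      using x by (auto simp: c00_iff_bounded_support)
    then have "f (r n) (J x) = (\<Sum>j\<le>k. x j * f (r n) (e j))" for n
      by (simp add: J_eq_sum blinfun.sum_right blinfun.scaleR_right)
    moreover have "(\<lambda>n. \<Sum>j\<le>k. x j * f (r n) (e j)) \<longlonglongrightarrow> (\<Sum>j\<le>k. x j * a j)"
      by (intro tendsto_intros a)
    ultimately have "convergent (\<lambda>n. f (r n) (J x))"
      by (auto simp: convergent_def)
    then show ?thesis
      by (simp add: l_def convergent_LIMSEQ_iff)
  qed
  obtain h :: "'a \<Rightarrow>\<^sub>L real" where h: "\<And>x. x \<in> c00 \<Longrightarrow> h (J x) = l x"
  proof (rule extend_functional[of l C])
    fix x y assume xy: "x \<in> c00" "y \<in> c00"
    have "(\<lambda>n. f (r n) (J (\<lambda>j. x j + y j))) \<longlonglongrightarrow> l x + l y"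
      using tendsto_add[OF l[OF xy(1)] l[OF xy(2)]] by (simp add: J_add xy blinfun.add_right)
    then show "l (\<lambda>j. x j + y j) = l x + l y"
      using l[OF c00_add[OF xy]] LIMSEQ_unique by blast
  next
    fix x and b :: real assume x: "x \<in> c00"
    have "(\<lambda>n. f (r n) (J (\<lambda>j. b * x j))) \<longlonglongrightarrow> b * l x"
      using tendsto_mult_left[OF l[OF x], of b] by (simp add: J_scale x blinfun.scaleR_right)
    then show "l (\<lambda>j. b * x j) = b * l x"
      using l[OF c00_scale[OF x]] LIMSEQ_unique by blast
  next
    fix x assume x: "x \<in> c00"
    have "\<bar>f (r n) (J x)\<bar> \<le> C * nrm x" for n
    proof -
      have "\<bar>f (r n) (J x)\<bar> \<le> norm (f (r n)) * nrm x"
        using norm_blinfun[of "f (r n)" "J x"] x by (simp add: norm_J)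
      also have "\<dots> \<le> C * nrm x"
        using bound by (intro mult_right_mono) auto
      finally show ?thesis .
    qed
    then show "\<bar>l x\<bar> \<le> C * nrm x"
      by (intro LIMSEQ_le_const2[OF tendsto_rabs[OF l[OF x]]]) auto
  qed blast
  have "(\<lambda>n. (f (r n) - h) z) \<longlonglongrightarrow> 0" for z
  proof (rule LIMSEQ_I)
    fix \<eta> :: real assume "0 < \<eta>"
    define B where "B = \<bar>C\<bar> + norm h + 1"
    have B: "0 < B" "norm (f n - h) \<le> B" for n
      using norm_triangle_ineq4[of "f n" h] bound[of n] by (auto simp: B_def intro: add_nonneg_pos)
    obtain x where x: "x \<in> c00" "norm (z - J x) < \<eta> / (2 * B)"
      using J_dense \<open>0 < \<eta>\<close> B closure_approachable[of z "J ` c00"]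
      by (fastforce simp: dist_norm norm_minus_commute dest!: spec[of _ "\<eta> / (2 * B)"])
    have "(\<lambda>n. f (r n) (J x) - h (J x)) \<longlonglongrightarrow> 0"
      using l[OF x(1)] h[OF x(1)] by (simp add: LIM_zero_iff)
    then obtain M where M: "\<And>n. M \<le> n \<Longrightarrow> \<bar>f (r n) (J x) - h (J x)\<bar> < \<eta> / 2"
      using \<open>0 < \<eta>\<close> LIMSEQ_D[of _ 0 "\<eta> / 2"] by fastforce
    have "norm ((f (r n) - h) z) < \<eta>" if "M \<le> n" for n
    proof -
      have "norm ((f (r n) - h) (z - J x)) \<le> norm (f (r n) - h) * norm (z - J x)"
        by (rule norm_blinfun)
      also have "\<dots> \<le> B * (\<eta> / (2 * B))"
        using B x by (intro mult_mono) auto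
      also have "\<dots> = \<eta> / 2"
        using B by simp
      finally show ?thesis
        using M[OF that] unfolding blinfun.diff_left blinfun.diff_right real_norm_def by linarith
    qed
    then show "\<exists>M. \<forall>n\<ge>M. norm ((f (r n) - h) z - 0) < \<eta>"
      by auto
  qed
  then show ?thesis
    using r weakly_null_iff that by blast
qed

section \<open>Weakly null perturbations\<close>

lemma trunc_weakly_null:
  assumes "weakly_null g" shows "(\<lambda>n. trunc m (g n)) \<longlonglongrightarrow> 0"
proof -
  have "(\<lambda>n. \<Sum>j\<le>m. g n (e j) *\<^sub>R coord j) \<longlonglongrightarrow> (\<Sum>j\<le>m. 0 *\<^sub>R coord j)"
    using assms weakly_null_iff by (intro tendsto_intros) auto
  then show ?thesis
    by (simp add: trunc_def)
qed

text \<open>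
  Cut \<open>f\<close> and \<open>f'\<close> at a large \<open>m\<close> and remove the first \<open>m + 1\<close> coordinates of \<open>g n\<close>, which tend
  to \<open>0\<close>; then \<open>dual_mono_head\<close> applies.  The strict inequality between the norms survives the
  cut.
\<close>

lemma norm_add_weakly_null_mono:
  fixes f f' :: "'a \<Rightarrow>\<^sub>L real"
  assumes g: "weakly_null g" and "norm f < norm f'" and "0 < \<eta>"
  shows "\<forall>\<^sub>F n in sequentially. norm (f + g n) \<le> norm (f' + g n) + \<eta>"
proof -
  have "\<forall>\<^sub>F m in sequentially. norm (trunc m f) < norm (trunc m f')"
    using order_tendstoD(1)[OF tendsto_diff[OF tendsto_norm tendsto_norm, OF trunc_tendsto trunc_tendsto],
        of 0 f' f] \<open>norm f < norm f'\<close> by simp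
  moreover have "\<forall>\<^sub>F m in sequentially. dist (trunc m f) f < \<eta> / 4" "\<forall>\<^sub>F m in sequentially. dist (trunc m f') f' < \<eta> / 4"
    using \<open>0 < \<eta>\<close> by (auto intro!: tendstoD trunc_tendsto simp del: less_divide_eq_numeral1)
  ultimately have "\<forall>\<^sub>F m in sequentially. norm (trunc m f) < norm (trunc m f') \<and>
      dist (trunc m f) f < \<eta> / 4 \<and> dist (trunc m f') f' < \<eta> / 4"
    by eventually_elim auto
  then obtain m where m: "norm (trunc m f) < norm (trunc m f')" "norm (f - trunc m f) < \<eta> / 4"
      "norm (trunc m f' - f') < \<eta> / 4"
    by (auto simp: dist_norm norm_minus_commute dest: eventually_happens)
  have "\<forall>\<^sub>F n in sequentially. dist (trunc m (g n)) 0 < \<eta> / 4"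
    using trunc_weakly_null[OF g] \<open>0 < \<eta>\<close> by (intro tendstoD) auto
  then show ?thesis
  proof eventually_elim
    case (elim n)
    let ?g = "g n - trunc m (g n)"
    have "norm (f + g n) \<le> norm (trunc m f + ?g) + (norm (f - trunc m f) + norm (trunc m (g n)))"
      using norm_triangle_le[of "trunc m f + ?g" "(f - trunc m f) + trunc m (g n)"]
        norm_triangle_ineq[of "f - trunc m f" "trunc m (g n)"] by (simp add: algebra_simps)
    moreover have "norm (trunc m f + ?g) \<le> norm (trunc m f' + ?g)"
      using m by (intro dual_mono_head) simp
    moreover have "norm (trunc m f' + ?g) \<le> norm (f' + g n) + (norm (trunc m f' - f') + norm (trunc m (g n)))"
      using norm_triangle_ineq[of "f' + g n" "(trunc m f' - f') - trunc m (g n)"]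
        norm_triangle_ineq4[of "trunc m f' - f'" "trunc m (g n)"] by (simp add: algebra_simps)
    ultimately show ?case
      using elim m by simp
  qed
qed

text \<open>
  A fixed initial segment of \<open>f + g n\<close> keeps a norm of at least \<open>d = \<parallel>f\<parallel> / 2\<close>, so that
  \<open>dual_pythagoras\<close> leaves at most \<open>\<surd>(1 - d\<^sup>2)\<close> for the rest, which is close to \<open>g n\<close>.
\<close>

lemma norm_weakly_null_less:
  fixes f :: "'a \<Rightarrow>\<^sub>L real"
  assumes g: "weakly_null g" and "f \<noteq> 0" and "\<And>n. norm (f + g n) \<le> 1"
  obtains \<rho> where "\<rho> < 1" "\<forall>\<^sub>F n in sequentially. norm (g n) \<le> \<rho>"
proof -
  define d where "d = norm f / 2"
  have d: "0 < d" "d < norm f"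
    using \<open>f \<noteq> 0\<close> by (auto simp: d_def)
  define \<sigma> where "\<sigma> = sqrt (1 - d\<^sup>2)"
  have \<sigma>: "\<sigma> < 1"
    using d by (simp add: \<sigma>_def)
  \<comment> \<open>The cut of \<open>f\<close> and the head of \<open>g n\<close> cost \<open>\<eta>\<close> each, so \<open>\<sigma> + 2 \<eta>\<close> is still below \<open>1\<close>.\<close>
  define \<eta> where "\<eta> = (1 - \<sigma>) / 4"
  have \<eta>: "0 < \<eta>"
    using \<sigma> by (simp add: \<eta>_def)
  have "\<forall>\<^sub>F m in sequentially. d < norm (trunc m f)"
    using d by (intro order_tendstoD(1)[OF tendsto_norm[OF trunc_tendsto]])
  moreover have "\<forall>\<^sub>F m in sequentially. dist (trunc m f) f < \<eta>"
    using \<eta> trunc_tendsto by (intro tendstoD)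
  ultimately have "\<forall>\<^sub>F m in sequentially. d < norm (trunc m f) \<and> dist (trunc m f) f < \<eta>"
    by eventually_elim auto
  then obtain m where m: "d < norm (trunc m f)" "norm (f - trunc m f) < \<eta>"
    by (auto simp: dist_norm norm_minus_commute dest: eventually_happens)
  have "(\<lambda>n. trunc m f + trunc m (g n)) \<longlonglongrightarrow> trunc m f + 0"
    by (intro tendsto_intros trunc_weakly_null g)
  then have "\<forall>\<^sub>F n in sequentially. d < norm (trunc m f + trunc m (g n))"
    using m by (intro order_tendstoD(1)[OF tendsto_norm]) auto
  moreover have "\<forall>\<^sub>F n in sequentially. dist (trunc m (g n)) 0 < \<eta>"
    using \<eta> trunc_weakly_null[OF g] by (intro tendstoD)
  ultimately have "\<forall>\<^sub>F n in sequentially. norm (g n) \<le> \<sigma> + 2 * \<eta>"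
  proof eventually_elim
    case (elim n)
    let ?h = "f + g n"
    have "d\<^sup>2 \<le> (norm (trunc m ?h))\<^sup>2"
      using elim d by (intro power_mono) (auto simp: trunc_add)
    moreover have "(norm ?h)\<^sup>2 \<le> 1\<^sup>2"
      using assms(3)[of n] by (intro power_mono) auto
    ultimately have "(norm (?h - trunc m ?h))\<^sup>2 \<le> 1 - d\<^sup>2"
      using dual_pythagoras[of m ?h] by simp
    then have "norm (?h - trunc m ?h) \<le> \<sigma>"
      by (simp add: \<sigma>_def real_le_rsqrt)
    moreover have "norm (g n) \<le> norm (?h - trunc m ?h) + (norm (f - trunc m f) + norm (trunc m (g n)))"
      using norm_triangle_ineq4[of "?h - trunc m ?h" "(f - trunc m f) - trunc m (g n)"]
        norm_triangle_ineq4[of "f - trunc m f" "trunc m (g n)"] by (simp add: trunc_add algebra_simps)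
    ultimately show ?case
      using elim m by simp
  qed
  then show ?thesis
    using \<sigma> by (intro that[of "\<sigma> + 2 * \<eta>"]) (auto simp: \<eta>_def field_simps)
qed

section \<open>The weak maximizing property\<close>

lemma weakly_null_image:
  fixes T :: "'e::real_normed_vector \<Rightarrow>\<^sub>L 'f::real_normed_vector"
  assumes "weakly_null g" shows "weakly_null (\<lambda>n. T (g n))"
  unfolding weakly_null_def
proof
  fix \<phi> :: "'f \<Rightarrow>\<^sub>L real"
  show "(\<lambda>n. \<phi> (T (g n))) \<longlonglongrightarrow> 0"
    using assms[unfolded weakly_null_def, rule_format, of "\<phi> o\<^sub>L T"] by simp
qed

text \<open>
  If the norm is not attained in the direction of \<open>f\<close>, then \<open>f\<close> can be replaced by a shorter vector
  with a longer image, and the uniform gap between \<open>\<parallel>g n\<parallel>\<close> and \<open>1\<close> makes this a definite loss.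
\<close>

lemma attained_at_weak_limit:
  fixes T :: "('a \<Rightarrow>\<^sub>L real) \<Rightarrow>\<^sub>L ('a \<Rightarrow>\<^sub>L real)"
  assumes g: "weakly_null g" and f: "f \<noteq> 0" and unit: "\<And>n. norm (f + g n) = 1"
    and max: "(\<lambda>n. norm (T (f + g n))) \<longlonglongrightarrow> norm T"
  shows "norm (T f) = norm T * norm f"
proof (rule ccontr)
  assume "norm (T f) \<noteq> norm T * norm f"
  then have less: "norm (T f) < norm T * norm f"
    using norm_blinfun[of T f] by simp
  have T: "0 < norm T"
    using less norm_ge_zero[of "T f"] by (cases "norm T = 0") auto
  have "norm (T f) / norm f < norm T"
    using less f by (simp add: field_simps)
  then have "\<not> (\<forall>w. norm (T w) \<le> norm (T f) / norm f * norm w)"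
    using norm_blinfun_bound[of "norm (T f) / norm f" T] by fastforce
  then obtain w where w: "norm (T f) / norm f * norm w < norm (T w)"
    by (meson not_le)
  have "0 \<le> norm (T f) / norm f * norm w"
    by simp
  then have "0 < norm (T w)"
    using w by linarith
  \<comment> \<open>As \<open>w\<close> is stretched more than \<open>f\<close>, a multiple \<open>r w\<close> is shorter than \<open>f\<close> with a longer image.\<close>
  have "norm (T f) / norm (T w) * norm w < norm f"
    using w \<open>0 < norm (T w)\<close> f by (simp add: field_simps)
  have "w \<noteq> 0"
    using \<open>0 < norm (T w)\<close> by auto
  then obtain r where r: "norm (T f) / norm (T w) < r" "r < norm f / norm w"
    using w f \<open>0 < norm (T w)\<close> dense[of "norm (T f) / norm (T w)" "norm f / norm w"]
    by (auto simp: field_simps)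
  have "0 \<le> norm (T f) / norm (T w)"
    by simp
  then have "0 < r"
    using r by linarith
  define z where "z = r *\<^sub>R w"
  have z: "norm (T f) < norm (T z)" "norm z < norm f"
    using r \<open>0 < r\<close> \<open>0 < norm (T w)\<close> \<open>w \<noteq> 0\<close> by (auto simp: z_def blinfun.scaleR_right field_simps)
  then obtain \<theta> where \<theta>: "norm z / norm f < \<theta>" "\<theta> < 1"
    using dense[of "norm z / norm f" 1] f by auto
  have "0 \<le> norm z / norm f"
    by simp
  then have "0 < \<theta>"
    using \<theta> by linarith
  have z\<theta>: "norm z < norm (\<theta> *\<^sub>R f)"
    using \<theta> f \<open>0 < \<theta>\<close> by (simp add: field_simps)
  \<comment> \<open>\<open>gap\<close> is the amount by which \<open>\<theta> + (1 - \<theta>) \<rho>\<close> falls short of \<open>1\<close>; the errors below use up half of it.\<close>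
  obtain \<rho> where \<rho>: "\<rho> < 1" "\<forall>\<^sub>F n in sequentially. norm (g n) \<le> \<rho>"
    using norm_weakly_null_less[OF g f] unit by (metis order_refl)
  define gap where "gap = (1 - \<theta>) * (1 - \<rho>)"
  have gap: "0 < gap"
    using \<theta> \<rho> by (simp add: gap_def)
  have "\<forall>\<^sub>F n in sequentially. norm (T f + T (g n)) \<le> norm (T z + T (g n)) + norm T * (gap / 4)"
    using weakly_null_image[OF g, of T] z T gap
    by (intro norm_add_weakly_null_mono) auto
  moreover have "\<forall>\<^sub>F n in sequentially. norm (z + g n) \<le> norm (\<theta> *\<^sub>R f + g n) + gap / 4"
    using g z\<theta> gap by (intro norm_add_weakly_null_mono) auto
  moreover note \<rho>(2)
  ultimately have "\<forall>\<^sub>F n in sequentially. norm (T (f + g n)) \<le> norm T * (1 - gap / 2)"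
  proof eventually_elim
    case (elim n)
    have "norm (\<theta> *\<^sub>R f + g n) = norm (\<theta> *\<^sub>R (f + g n) + (1 - \<theta>) *\<^sub>R g n)"
      by (simp add: algebra_simps)
    also have "\<dots> \<le> \<theta> * norm (f + g n) + (1 - \<theta>) * norm (g n)"
      using norm_triangle_ineq[of "\<theta> *\<^sub>R (f + g n)" "(1 - \<theta>) *\<^sub>R g n"] \<theta> \<open>0 < \<theta>\<close> by simp
    also have "\<dots> \<le> \<theta> * 1 + (1 - \<theta>) * \<rho>"
      using unit[of n] elim \<theta> \<open>0 < \<theta>\<close> by (intro add_mono mult_left_mono) auto
    also have "\<dots> = 1 - gap"
      by (simp add: gap_def algebra_simps)
    finally have "norm (z + g n) \<le> 1 - 3 / 4 * gap"
      using elim by simp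
    then have "norm T * norm (z + g n) \<le> norm T * (1 - 3 / 4 * gap)"
      by (intro mult_left_mono) auto
    then have "norm (T z + T (g n)) \<le> norm T * (1 - 3 / 4 * gap)"
      using norm_blinfun[of T "z + g n"] by (simp add: blinfun.add_right)
    then show ?case
      using elim by (simp add: blinfun.add_right algebra_simps)
  qed
  then have "norm T \<le> norm T * (1 - gap / 2)"
    using max by (intro tendsto_upperbound[OF max]) auto
  then show False
    using mult_pos_pos[OF T gap] by (simp add: algebra_simps)
qed

lemma weak_maximizing: "weak_maximizing_property TYPE('a \<Rightarrow>\<^sub>L real) TYPE('a \<Rightarrow>\<^sub>L real)"
  unfolding weak_maximizing_property_def
proof (intro allI impI)
  fix T :: "('a \<Rightarrow>\<^sub>L real) \<Rightarrow>\<^sub>L ('a \<Rightarrow>\<^sub>L real)"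
  assume "\<exists>x. maximizing_sequence T x \<and> \<not> weakly_null x"
  then obtain x where x: "\<And>n. norm (x n) = 1" "(\<lambda>n. norm (T (x n))) \<longlonglongrightarrow> norm T"
    and "\<not> weakly_null x"
    by (auto simp: maximizing_sequence_def)
  then obtain z where "\<not> (\<lambda>n. x n z) \<longlonglongrightarrow> 0"
    using weakly_null_iff by blast
  then obtain \<epsilon> where "0 < \<epsilon>" and "\<not> (\<forall>\<^sub>F n in sequentially. \<bar>x n z\<bar> < \<epsilon>)"
    unfolding tendsto_iff by auto
  \<comment> \<open>The subsequence keeps \<open>x\<close> away from \<open>0\<close> at the point \<open>z\<close>, which forces a nonzero weak limit.\<close>
  then have "infinite {n. \<epsilon> \<le> \<bar>x n z\<bar>}"
    by (simp add: not_eventually frequently_cofinite flip: cofinite_eq_sequentially) (simp add: not_less)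
  then obtain s where s: "strict_mono (s :: nat \<Rightarrow> nat)" "\<And>n. \<epsilon> \<le> \<bar>x (s n) z\<bar>"
    using infinite_enumerate by blast
  obtain r f where r: "strict_mono (r :: nat \<Rightarrow> nat)" and g: "weakly_null (\<lambda>n. x (s (r n)) - f)"
    using weak_limit_subseq[of "\<lambda>n. x (s n)" 1] x(1) by auto
  have f: "f \<noteq> 0"
  proof
    assume "f = 0"
    then have "(\<lambda>n. \<bar>x (s (r n)) z\<bar>) \<longlonglongrightarrow> \<bar>0\<bar>"
      using g weakly_null_iff by (intro tendsto_rabs) simp
    then have "\<epsilon> \<le> \<bar>0\<bar>"
      by (rule LIMSEQ_le_const) (use s(2) in auto)
    then show False
      using \<open>0 < \<epsilon>\<close> by simp
  qed
  have "strict_mono (\<lambda>n. s (r n))"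
    using strict_mono_o[OF s(1) r] by (simp add: o_def)
  then have "(\<lambda>n. norm (T (x (s (r n))))) \<longlonglongrightarrow> norm T"
    using LIMSEQ_subseq_LIMSEQ[OF x(2), of "\<lambda>n. s (r n)"] by (simp add: o_def)
  then have "norm (T f) = norm T * norm f"
    using x(1) by (intro attained_at_weak_limit[OF g f]) auto
  then show "attains_norm T"
    unfolding attains_norm_def using f
    by (intro exI[of _ "(1 / norm f) *\<^sub>R f"]) (simp add: blinfun.scaleR_right)
qed

end

theorem theorem5p4:
  fixes c :: real and J :: "(nat \<Rightarrow> real) \<Rightarrow> 'a::banach"
  assumes "0 < c" and "c < 1" and "is_Xc c J"
  shows "weak_maximizing_property TYPE('a \<Rightarrow>\<^sub>L real) TYPE('a \<Rightarrow>\<^sub>L real)"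
proof -
  interpret Xc_space c J
    using assms by unfold_locales
  show ?thesis
    by (rule weak_maximizing)
qed

end
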